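(* Let $\mathbf{A}\in\mathbb{R}^{n\times d}$ be nonzero, $\mathbf{b}\in\operatorname{range}(\mathbf{A})$, $\mathbf{x}^*:=\mathbf{A}^+\mathbf{b}$, and $0<\varepsilon<1/4$. Run the algorithm described in the context with parameters $\alpha = 1/\|\mathbf{A}\|^2$, $R = \lceil 2\kappa_{\mathsf F}^2/\kappa^2\rceil$, $C=\lceil 10\kappa_{\mathsf F}^2/\varepsilon^2\rceil$, $K=\lceil 4\kappa^2\log(1/\varepsilon)\rceil$, let $\mathbf{y}$ be its output and $\mathbf{x}=\mathbf{A}^{\mathsf T}\mathbf{y}$. Then $$\mathbb{E}\big[\|\mathbf{x}^*-\mathbf{x}\|^2\big]\le 2\varepsilon^2\|\mathbf{x}^*\|^2.$$
   Context: Notation: $\|\cdot\|$ is the Euclidean norm / spectral norm, $\|\cdot\|_{\mathsf F}$ the Frobenius norm, $\mathbf{A}^+$ the pseudoinverse, $\kappa:=\|\mathbf{A}\|\|\mathbf{A}^+\|$, $\kappa_{\mathsf F}:=\|\mathbf{A}\|_{\mathsf F}\|\mathbf{A}^+\|$. Let $p_r=\|\mathbf{e}_r^{\mathsf T}\mathbf{A}\|^2/\|\mathbf{A}\|_{\mathsf F}^2$ ($r=1,\dots,n$) and $q_c=\|\mathbf{A}\mathbf{e}_c\|^2/\|\mathbf{A}\|_{\mathsf F}^2$ ($c=1,\dots,d$). Algorithm: set $\mathbf{y}=\mathbf{0}\in\mathbb{R}^n$. For $k=1,\dots,K$: draw a list $\mathcal{C}_k$ of $C$ column indices i.i.d. from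 $q$; for each $c\in\mathcal{C}_k$ compute $\beta_c=\sum_{i}A_{i,c}y_i$ (with the current $\mathbf{y}$); draw a list $\mathcal{R}_k$ of $R$ row indices i.i.d. from $p$ (all draws independent); for each $r\in\mathcal{R}_k$ compute $\gamma_r=\big(\frac1C\sum_{c\in\mathcal{C}_k}q_c^{-1}A_{r,c}\beta_c\big)-b_r$ and update $y_r\gets y_r-\alpha\gamma_r/(Rp_r)$. Equivalently, $\mathbf{y}_{k+1}=\mathbf{y}_k-\alpha\frac1R\sum_{r\in\mathcal{R}_k}p_r^{-1}\mathbf{e}_r\big(\frac1C\sum_{c\in\mathcal{C}_k}q_c^{-1}A_{r,c}(\mathbf{A}^{\mathsf T}\mathbf{y}_k)_c-b_r\big)$ starting from $\mathbf{0}$. Output the final $\mathbf{y}$. *)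

theory Defs
  imports "HOL-Analysis.Analysis" "HOL-Probability.Probability"
begin

text \<open>A matrix with rows indexed by \<open>'n\<close> and columns indexed by \<open>'d\<close> is an element of
  \<^typ>\<open>real^'d^'n\<close>.\<close>

definition spectral_norm :: "real^'d^'n \<Rightarrow> real" where
  "spectral_norm A = onorm ((*v) A)"

definition frobenius_norm :: "real^'d^'n \<Rightarrow> real" where
  "frobenius_norm A = sqrt (\<Sum>i\<in>UNIV. \<Sum>j\<in>UNIV. (A $ i $ j)\<^sup>2)"

definition is_pinv :: "real^'d^'n \<Rightarrow> real^'n^'d \<Rightarrow> bool" where
  "is_pinv A X \<longleftrightarrow> A ** X ** A = A \<and> X ** A ** X = X \<and>
     transpose (A ** X) = A ** X \<and> transpose (X ** A) = X ** A"

definition pinv :: "real^'d^'n \<Rightarrow> real^'n^'d" where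
  "pinv A = (THE X. is_pinv A X)"

definition cond_num :: "real^'d^'n \<Rightarrow> real" where
  "cond_num A = spectral_norm A * spectral_norm (pinv A)"

definition cond_num_F :: "real^'d^'n \<Rightarrow> real" where
  "cond_num_F A = frobenius_norm A * spectral_norm (pinv A)"

definition row_prob :: "real^'d^'n \<Rightarrow> 'n \<Rightarrow> real" where
  "row_prob A r = (norm (row r A))\<^sup>2 / (frobenius_norm A)\<^sup>2"

definition col_prob :: "real^'d^'n \<Rightarrow> 'd \<Rightarrow> real" where
  "col_prob A c = (norm (column c A))\<^sup>2 / (frobenius_norm A)\<^sup>2"

text \<open>For \<open>A \<noteq> 0\<close> these have the mass functions above, see \<open>pmf_row_pmf\<close> and \<open>pmf_col_pmf\<close>
  below; for \<open>A = 0\<close> they are unspecified.\<close>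

definition row_pmf :: "real^'d^'n \<Rightarrow> 'n pmf" where
  "row_pmf A = embed_pmf (row_prob A)"

definition col_pmf :: "real^'d^'n \<Rightarrow> 'd pmf" where
  "col_pmf A = embed_pmf (col_prob A)"

text \<open>Samples are lists, so repeated indices count with multiplicity. In the residual, \<open>\<beta>\<close> is
  indexed by the column index rather than by the position in the sample, which is harmless
  because \<open>\<beta>\<^sub>c\<close> depends on \<open>c\<close> and on the iterate only.\<close>

definition residual ::
  "nat \<Rightarrow> real^'d^'n \<Rightarrow> real^'n \<Rightarrow> 'd list \<Rightarrow> ('d \<Rightarrow> real) \<Rightarrow> 'n \<Rightarrow> real" where
  "residual C A b cs \<beta> r =
     1 / real C * (\<Sum>c\<leftarrow>cs. inverse (col_prob A c) * A $ r $ c * \<beta> c) - b $ r"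

definition row_update ::
  "real \<Rightarrow> nat \<Rightarrow> real^'d^'n \<Rightarrow> ('n \<Rightarrow> real) \<Rightarrow> 'n \<Rightarrow> real^'n \<Rightarrow> real^'n" where
  "row_update \<alpha> R A \<gamma> r y =
     (\<chi> i. if i = r then y $ i - \<alpha> * \<gamma> r / (real R * row_prob A r) else y $ i)"

definition iteration ::
  "real \<Rightarrow> nat \<Rightarrow> nat \<Rightarrow> real^'d^'n \<Rightarrow> real^'n \<Rightarrow> real^'n \<Rightarrow> (real^'n) pmf" where
  "iteration \<alpha> R C A b y = do {
     cs \<leftarrow> replicate_pmf C (col_pmf A);
     let \<beta> = (\<lambda>c. \<Sum>i\<in>UNIV. A $ i $ c * y $ i);
     rs \<leftarrow> replicate_pmf R (row_pmf A);
     return_pmf (fold (row_update \<alpha> R A (residual C A b cs \<beta>)) rs y)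
   }"

text \<open>The distribution of the iterate after \<open>K\<close> iterations started at \<open>0\<close>.\<close>

primrec algorithm ::
  "real \<Rightarrow> nat \<Rightarrow> nat \<Rightarrow> real^'d^'n \<Rightarrow> real^'n \<Rightarrow> nat \<Rightarrow> (real^'n) pmf" where
  "algorithm \<alpha> R C A b 0 = return_pmf 0"
| "algorithm \<alpha> R C A b (Suc k) = algorithm \<alpha> R C A b k \<bind> iteration \<alpha> R C A b"


subsection \<open>Well-definedness and the closed form of an iteration\<close>

lemma frobenius_norm_rows: "(frobenius_norm A)\<^sup>2 = (\<Sum>r\<in>UNIV. (norm (row r A))\<^sup>2)"
  by (simp add: frobenius_norm_def norm_vec_def L2_set_def row_def sum_nonneg)

lemma frobenius_norm_columns: "(frobenius_norm A)\<^sup>2 = (\<Sum>c\<in>UNIV. (norm (column c A))\<^sup>2)"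
proof -
  have "(frobenius_norm A)\<^sup>2 = (\<Sum>i\<in>UNIV. \<Sum>j\<in>UNIV. (A $ i $ j)\<^sup>2)"
    by (simp add: frobenius_norm_def sum_nonneg)
  also have "\<dots> = (\<Sum>c\<in>UNIV. (norm (column c A))\<^sup>2)"
    by (subst sum.swap) (simp add: norm_vec_def L2_set_def column_def sum_nonneg)
  finally show ?thesis .
qed

lemma frobenius_norm_eq_0: "frobenius_norm A = 0 \<longleftrightarrow> A = 0"
  by (simp add: frobenius_norm_def sum_nonneg_eq_0_iff sum_nonneg vec_eq_iff)

lemma pmf_row_pmf:
  assumes "A \<noteq> 0"
  shows "pmf (row_pmf A) r = row_prob A r"
  unfolding row_pmf_def
proof (rule pmf_embed_pmf)
  show "0 \<le> row_prob A r" for r by (simp add: row_prob_def)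
  have "(\<Sum>r\<in>UNIV. row_prob A r) = 1"
    using assms unfolding row_prob_def sum_divide_distrib[symmetric] frobenius_norm_rows[symmetric]
    by (simp add: frobenius_norm_eq_0)
  then show "(\<integral>\<^sup>+ r. ennreal (row_prob A r) \<partial>count_space UNIV) = 1"
    by (simp add: nn_integral_count_space_finite sum_ennreal row_prob_def)
qed

lemma pmf_col_pmf:
  assumes "A \<noteq> 0"
  shows "pmf (col_pmf A) c = col_prob A c"
  unfolding col_pmf_def
proof (rule pmf_embed_pmf)
  show "0 \<le> col_prob A c" for c by (simp add: col_prob_def)
  have "(\<Sum>c\<in>UNIV. col_prob A c) = 1"
    using assms
    unfolding col_prob_def sum_divide_distrib[symmetric] frobenius_norm_columns[symmetric]
    by (simp add: frobenius_norm_eq_0)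
  then show "(\<integral>\<^sup>+ c. ennreal (col_prob A c) \<partial>count_space UNIV) = 1"
    by (simp add: nn_integral_count_space_finite sum_ennreal col_prob_def)
qed

lemma fold_row_update:
  "fold (row_update \<alpha> R A \<gamma>) rs y =
     y - (\<alpha> * (1 / real R)) *\<^sub>R (\<Sum>r\<leftarrow>rs. (inverse (row_prob A r) * \<gamma> r) *\<^sub>R axis r 1)"
proof (induction rs arbitrary: y)
  case (Cons r rs)
  have "row_update \<alpha> R A \<gamma> r y =
          y - (\<alpha> * (1 / real R)) *\<^sub>R ((inverse (row_prob A r) * \<gamma> r) *\<^sub>R axis r 1)"
    by (simp add: row_update_def vec_eq_iff axis_def divide_inverse)
  then show ?case
    by (simp add: Cons.IH scaleR_add_right diff_diff_eq)
qed simp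

lemma is_pinv_unique:
  assumes X: "is_pinv A X" and Y: "is_pinv A Y"
  shows "X = Y"
proof -
  have eqs: "A ** X ** A = A" "X ** A ** X = X" "A ** Y ** A = A" "Y ** A ** Y = Y"
    and sym: "transpose (A ** X) = A ** X" "transpose (X ** A) = X ** A"
      "transpose (A ** Y) = A ** Y" "transpose (Y ** A) = Y ** A"
    using X Y by (auto simp: is_pinv_def)
  have "A ** X = transpose (A ** Y ** A ** X)"
    using eqs(3) sym(1) by simp
  also have "\<dots> = A ** X ** (A ** Y)"
    by (metis matrix_mul_assoc matrix_transpose_mul sym(1,3))
  also have "\<dots> = A ** Y"
    by (simp add: matrix_mul_assoc eqs(1))
  finally have AX: "A ** X = A ** Y" .
  have "X ** A = transpose (X ** (A ** Y ** A))"
    using eqs(3) sym(2) by simp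
  also have "\<dots> = Y ** A ** (X ** A)"
    by (metis matrix_mul_assoc matrix_transpose_mul sym(2,4))
  also have "\<dots> = Y ** (A ** X ** A)"
    by (simp add: matrix_mul_assoc)
  finally have XA: "X ** A = Y ** A"
    by (simp add: eqs(1))
  show ?thesis
    by (metis AX XA eqs(2,4) matrix_mul_assoc)
qed

lemma is_pinv_exists:
  fixes A :: "real^'d^'n"
  shows "\<exists>X. is_pinv A X"
proof -
  note transpose_matrix_vector [simp del]
  let ?V = "range ((*v) (transpose A))"
  have adj: "(A *v x) \<bullet> z = x \<bullet> (transpose A *v z)" for x z
    by (metis dot_lmul_matrix inner_commute transpose_matrix_vector)
  have subV: "subspace ?V" and subW: "subspace (range ((*v) A))"
    by (rule linear_subspace_image[OF matrix_vector_mul_linear subspace_UNIV])+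
  have inj: "v = 0" if v: "v \<in> ?V" and "transpose A *v (A *v v) = 0" for v
  proof -
    have "A *v v = 0"
      using adj[of v "A *v v"] that by simp
    moreover obtain u where "v = transpose A *v u" using v by blast
    ultimately have "v \<bullet> v = 0" using adj[of v u] by simp
    then show ?thesis by simp
  qed
  have "\<exists>v\<in>?V. transpose A *v (z - A *v v) = 0" for z
  proof -
    obtain y t where y: "y \<in> range ((*v) A)" and t: "\<And>w. w \<in> range ((*v) A) \<Longrightarrow> orthogonal t w"
      and z: "z = y + t"
      using orthogonal_subspace_decomp_exists[of "range ((*v) A)" z] span_eq_iff subW by metis
    obtain x where x: "y = A *v x" using y by blast
    obtain v w where v: "v \<in> ?V" and w: "\<And>u. u \<in> ?V \<Longrightarrow> orthogonal w u" and xw: "x = v + w"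
      using orthogonal_subspace_decomp_exists[of ?V x] span_eq_iff subV by metis
    have "(A *v w) \<bullet> (A *v w) = 0"
      using w[of "transpose A *v (A *v w)"] by (simp add: adj orthogonal_def)
    then have "z - A *v v = t"
      by (simp add: z x xw matrix_vector_right_distrib)
    moreover have "(transpose A *v t) \<bullet> (transpose A *v t) = 0"
      using t[of "A *v (transpose A *v t)"]
      by (simp add: orthogonal_def inner_commute[of t] adj)
    ultimately show ?thesis using v by auto
  qed
  then obtain g where gV: "\<And>z. g z \<in> ?V" and g: "\<And>z. transpose A *v (z - A *v g z) = 0"
    by metis
  have gI: "g z = v" if "v \<in> ?V" "transpose A *v (z - A *v v) = 0" for z v
  proof -
    have "g z - v \<in> ?V" using gV that(1) subV by (simp add: subspace_diff)
    moreover have "transpose A *v (A *v (g z - v)) = 0"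
      using g[of z] that(2) by (simp add: matrix_vector_mult_diff_distrib)
    ultimately have "g z - v = 0" by (rule inj)
    then show ?thesis by simp
  qed
  have lin: "linear g"
  proof (rule linearI)
    fix x y c
    show "g (x + y) = g x + g y"
      using g[of x] g[of y] gV subV
      by (intro gI) (auto simp: subspace_add matrix_vector_mult_diff_distrib
          matrix_vector_right_distrib)
    show "g (c *\<^sub>R x) = c *\<^sub>R g x"
      using g[of x] gV subV
      by (intro gI) (auto simp: subspace_scale matrix_vector_mult_diff_distrib
          matrix_vector_mult_scaleR)
  qed
  define X where "X = matrix g"
  have X: "X *v z = g z" for z
    unfolding X_def by (simp add: lin matrix_works)
  have gA: "g (A *v v) = v" if "v \<in> ?V" for v
    by (rule gI) (use that in auto)
  have res: "(A *v u) \<bullet> (z - A *v g z) = 0" for u z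
    by (simp add: adj g)
  have AgA: "A *v g (A *v x) = A *v x" for x
    using res[of "x - g (A *v x)" "A *v x"] by (simp add: matrix_vector_mult_diff_distrib)
  have symI: "transpose M = M" if "\<And>u w. (M *v u) \<bullet> w = u \<bullet> (M *v w)" for M :: "real^'k^'k"
  proof -
    have "w \<bullet> (M *v u) = w \<bullet> (transpose M *v u)" for u w
      using that[of w u] by (metis dot_lmul_matrix inner_commute transpose_matrix_vector)
    then have "M *v u = transpose M *v u" for u
      using vector_eq_ldot[of "M *v u" "transpose M *v u"] by blast
    then show ?thesis by (simp add: matrix_eq)
  qed
  have sym1: "(A *v g u) \<bullet> w = u \<bullet> (A *v g w)" for u w
    using res[of "g u" w] res[of "g w" u] by (simp add: inner_diff_right inner_commute)
  have perp: "v \<bullet> (x - g (A *v x)) = 0" if v: "v \<in> ?V" for v x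
  proof -
    obtain u where "v = transpose A *v u" using v by blast
    then have "v \<bullet> (x - g (A *v x)) = (A *v (x - g (A *v x))) \<bullet> u"
      by (simp add: adj[of _ u] inner_commute[of "transpose A *v u"])
    then show ?thesis
      by (simp add: AgA matrix_vector_mult_diff_distrib)
  qed
  have sym2: "g (A *v u) \<bullet> w = u \<bullet> g (A *v w)" for u w
    using perp[OF gV, of "A *v u" w] perp[OF gV, of "A *v w" u]
    by (simp add: inner_diff_right inner_commute)
  have "is_pinv A X"
    unfolding is_pinv_def
  proof (intro conjI)
    show "A ** X ** A = A" "X ** A ** X = X"
      by (simp_all add: matrix_eq X AgA gA gV flip: matrix_vector_mul_assoc)
    show "transpose (A ** X) = A ** X" "transpose (X ** A) = X ** A"
      by (rule symI, simp add: X sym1 sym2 flip: matrix_vector_mul_assoc)+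
  qed
  then show ?thesis ..
qed

lemma is_pinv_pinv: "is_pinv A (pinv A)"
  unfolding pinv_def using is_pinv_exists is_pinv_unique by (metis theI)

end

theory Submission
  imports Defs
begin

text \<open>Write \<open>e = A\<^sup>T y - x\<^sup>*\<close>, and let \<open>\<gamma>\<close> be the sampled residual, an unbiased estimate of \<open>A e\<close>.
  By the choice of \<open>R\<close>, averaging over the rows gives at most
  \<open>\<parallel>e\<parallel>\<^sup>2 - 2 \<alpha> \<langle>A e, \<gamma>\<rangle> + 3/2 \<alpha> \<parallel>\<gamma>\<parallel>\<^sup>2\<close>. Averaging over the columns
  leaves \<open>\<parallel>e\<parallel>\<^sup>2 - \<alpha>/2 \<parallel>A e\<parallel>\<^sup>2\<close> plus a variance term, which the choice of \<open>C\<close> makes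
  of order \<open>\<epsilon>\<^sup>2 / \<kappa>\<^sup>2\<close>. Since \<open>e\<close> lies in the row space, \<open>\<alpha> \<parallel>A e\<parallel>\<^sup>2 \<ge> \<parallel>e\<parallel>\<^sup>2 / \<kappa>\<^sup>2\<close>,
  so the expected squared error satisfies an affine recurrence with contraction factor about
  \<open>1 - 1 / (2 \<kappa>\<^sup>2)\<close>.\<close>

section \<open>Moments of sums over i.i.d. samples\<close>

lemma norm_plus_sq: "(norm (x + y))\<^sup>2 = (norm x)\<^sup>2 + 2 * (x \<bullet> y) + (norm y)\<^sup>2"
  for x y :: "'a :: real_inner"
  by (simp add: power2_norm_eq_inner inner_commute algebra_simps)

lemma norm_minus_sq: "(norm (x - y))\<^sup>2 = (norm x)\<^sup>2 - 2 * (x \<bullet> y) + (norm y)\<^sup>2"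
  for x y :: "'a :: real_inner"
  by (simp add: power2_norm_eq_inner inner_commute algebra_simps)

text \<open>Finite supports turn both sides into finite sums, which settles integrability even
  though the squared error is unbounded.\<close>

lemma expectation_bind_pmf:
  fixes h :: "'b \<Rightarrow> 'c :: {banach, second_countable_topology}"
  assumes "finite (set_pmf p)" and "\<And>x. x \<in> set_pmf p \<Longrightarrow> finite (set_pmf (f x))"
  shows "measure_pmf.expectation (p \<bind> f) h =
    measure_pmf.expectation p (\<lambda>x. measure_pmf.expectation (f x) h)"
  using assms
  by (simp add: pmf_expectation_bind[OF assms(1)] integral_measure_pmf[OF assms(1)])

lemma finite_set_replicate_pmf:
  "finite (set_pmf p) \<Longrightarrow> finite (set_pmf (replicate_pmf n p))"
  by (induction n) auto

lemma expectation_replicate_pmf_sum: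
  fixes g :: "'a :: finite \<Rightarrow> 'b :: euclidean_space"
  shows "measure_pmf.expectation (replicate_pmf n p) (\<lambda>xs. \<Sum>x\<leftarrow>xs. g x) =
    real n *\<^sub>R measure_pmf.expectation p g"
proof (induction n)
  case (Suc n)
  have fin: "finite (set_pmf (replicate_pmf n p))"
    by (simp add: finite_set_replicate_pmf)
  show ?case
    by (simp add: expectation_bind_pmf fin Suc.IH integrable_measure_pmf_finite algebra_simps)
qed simp

text \<open>Expanding the square gives \<open>n\<close> diagonal terms, each a second moment, and
  \<open>n * (n - 1)\<close> ordered pairs of distinct positions, whose inner products factor by
  independence.\<close>

lemma expectation_replicate_pmf_norm_sum:
  fixes g :: "'a :: finite \<Rightarrow> 'b :: euclidean_space"
  shows "measure_pmf.expectation (replicate_pmf n p) (\<lambda>xs. (norm (\<Sum>x\<leftarrow>xs. g x))\<^sup>2) =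
    real n * measure_pmf.expectation p (\<lambda>x. (norm (g x))\<^sup>2)
      + real n * (real n - 1) * (norm (measure_pmf.expectation p g))\<^sup>2"
proof (induction n)
  case (Suc n)
  have fin: "finite (set_pmf (replicate_pmf n p))"
    by (simp add: finite_set_replicate_pmf)
  let ?\<mu> = "measure_pmf.expectation p g"
  have step: "measure_pmf.expectation (replicate_pmf n p) (\<lambda>xs. (norm (g x + (\<Sum>x\<leftarrow>xs. g x)))\<^sup>2) =
      (norm (g x))\<^sup>2 + 2 * real n * (g x \<bullet> ?\<mu>) +
      measure_pmf.expectation (replicate_pmf n p) (\<lambda>xs. (norm (\<Sum>x\<leftarrow>xs. g x))\<^sup>2)" for x
    by (simp add: norm_plus_sq integrable_measure_pmf_finite fin expectation_replicate_pmf_sum)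
  show ?case
    by (simp add: expectation_bind_pmf fin step Suc.IH integrable_measure_pmf_finite
        power2_norm_eq_inner[of ?\<mu>] algebra_simps)
qed simp

text \<open>Bias-variance split: averaging \<open>n\<close> draws divides the variance by
  \<open>n\<close>, and the variance is bounded by the second moment. It serves the rows with
  \<open>a = \<alpha>\<close> and the columns with \<open>a = 1\<close>.\<close>

lemma expectation_replicate_pmf_norm_diff_le:
  fixes g :: "'a :: finite \<Rightarrow> 'b :: euclidean_space"
  assumes "n > 0"
  shows "measure_pmf.expectation (replicate_pmf n p)
      (\<lambda>xs. (norm (v - (a * (1 / real n)) *\<^sub>R (\<Sum>x\<leftarrow>xs. g x)))\<^sup>2)
    \<le> (norm (v - a *\<^sub>R measure_pmf.expectation p g))\<^sup>2
      + a\<^sup>2 / real n * measure_pmf.expectation p (\<lambda>x. (norm (g x))\<^sup>2)"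
proof -
  have fin: "finite (set_pmf (replicate_pmf n p))"
    by (simp add: finite_set_replicate_pmf)
  let ?\<mu> = "measure_pmf.expectation p g" and ?m = "measure_pmf.expectation p (\<lambda>x. (norm (g x))\<^sup>2)"
  have sq: "(norm (v - c *\<^sub>R s))\<^sup>2 = (norm v)\<^sup>2 - (2 * c) * (v \<bullet> s) + c\<^sup>2 * (norm s)\<^sup>2" for c s
    by (simp add: norm_minus_sq power_mult_distrib)
  have "measure_pmf.expectation (replicate_pmf n p)
      (\<lambda>xs. (norm (v - (a * (1 / real n)) *\<^sub>R (\<Sum>x\<leftarrow>xs. g x)))\<^sup>2)
    = (norm v)\<^sup>2 - (2 * (a * (1 / real n))) * (v \<bullet> (real n *\<^sub>R ?\<mu>)) +
      (a * (1 / real n))\<^sup>2 * (real n * ?m + real n * (real n - 1) * (norm ?\<mu>)\<^sup>2)"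
    unfolding sq
    by (simp add: integrable_measure_pmf_finite fin expectation_replicate_pmf_sum
        expectation_replicate_pmf_norm_sum)
  also have "\<dots> = (norm (v - a *\<^sub>R ?\<mu>))\<^sup>2 + a\<^sup>2 / real n * ?m - a\<^sup>2 / real n * (norm ?\<mu>)\<^sup>2"
    unfolding sq using assms by (simp add: field_simps power2_eq_square)
  also have "\<dots> \<le> (norm (v - a *\<^sub>R ?\<mu>))\<^sup>2 + a\<^sup>2 / real n * ?m"
    by simp
  finally show ?thesis .
qed

text \<open>Where \<open>pmf p x = 0\<close>, the weight is the junk value \<open>inverse 0 = 0\<close>; the first hypothesis
  excludes that a vector lost in this way contributes to the mean.\<close>

lemma
  fixes w :: "'a :: finite \<Rightarrow> 'b :: euclidean_space"
  assumes p: "\<And>x. pmf p x * F = (norm (w x))\<^sup>2"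
  shows expectation_importance_weighted:
      "measure_pmf.expectation p (\<lambda>x. (inverse (pmf p x) * c x) *\<^sub>R w x) = (\<Sum>x\<in>UNIV. c x *\<^sub>R w x)"
    and expectation_importance_weighted_norm_le:
      "0 \<le> F \<Longrightarrow> measure_pmf.expectation p (\<lambda>x. (norm ((inverse (pmf p x) * c x) *\<^sub>R w x))\<^sup>2)
        \<le> F * (\<Sum>x\<in>UNIV. (c x)\<^sup>2)"
proof -
  have cancel: "pmf p x *\<^sub>R ((inverse (pmf p x) * c x) *\<^sub>R w x) = c x *\<^sub>R w x" for x
    using p[of x] by (cases "pmf p x = 0") auto
  show "measure_pmf.expectation p (\<lambda>x. (inverse (pmf p x) * c x) *\<^sub>R w x)
      = (\<Sum>x\<in>UNIV. c x *\<^sub>R w x)"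
    by (simp add: integral_measure_pmf[of UNIV] cancel del: scaleR_scaleR)
  \<comment> \<open>Equality where \<open>pmf p x\<close> is nonzero: the squared weight contributes
    two inverse factors, cancelled by the outer mass and by
    \<open>(norm (w x))\<^sup>2 = pmf p x * F\<close>.\<close>
  have le: "pmf p x * (norm ((inverse (pmf p x) * c x) *\<^sub>R w x))\<^sup>2 \<le> F * (c x)\<^sup>2" if "0 \<le> F" for x
    using that p[of x, symmetric]
    by (cases "pmf p x = 0") (auto simp: power_mult_distrib power2_eq_square field_simps)
  show "measure_pmf.expectation p (\<lambda>x. (norm ((inverse (pmf p x) * c x) *\<^sub>R w x))\<^sup>2)
        \<le> F * (\<Sum>x\<in>UNIV. (c x)\<^sup>2)" if "0 \<le> F"
    unfolding sum_distrib_left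
      integral_measure_pmf[OF finite, of p _ UNIV, simplified UNIV_I, simplified] real_scaleR_def
    by (intro sum_mono le that)
qed

section \<open>Spectral norm and transpose\<close>

lemma norm_matrix_vector_le: "norm (A *v x) \<le> spectral_norm A * norm x"
  unfolding spectral_norm_def by (rule onorm) simp

lemma inner_matrix_vector: "(A *v x) \<bullet> z = x \<bullet> (transpose A *v z)"
  for A :: "real^'d^'n"
  using dot_lmul_matrix[of z A x] by (simp add: inner_commute)

text \<open>Moving one factor of \<open>norm (transpose A *v z)\<close> squared across the inner
  product gives a bound by \<open>spectral_norm A\<close> times that same norm, which then cancels
  if nonzero.\<close>

lemma norm_transpose_matrix_vector_le: "norm (transpose A *v z) \<le> spectral_norm A * norm z"
proof (cases "norm (transpose A *v z) = 0")
  case False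
  have "norm (transpose A *v z) * norm (transpose A *v z) = (A *v (transpose A *v z)) \<bullet> z"
    by (subst inner_matrix_vector) (simp only: flip: power2_norm_eq_inner power2_eq_square)
  also have "\<dots> \<le> norm (A *v (transpose A *v z)) * norm z"
    by (rule norm_cauchy_schwarz)
  also have "\<dots> \<le> spectral_norm A * norm (transpose A *v z) * norm z"
    by (intro mult_right_mono norm_matrix_vector_le) auto
  finally show ?thesis using False by (simp add: mult_ac del: transpose_matrix_vector)
next
  case True
  moreover have "0 \<le> spectral_norm A"
    unfolding spectral_norm_def by (rule onorm_pos_le) simp
  ultimately show ?thesis by (simp only: mult_nonneg_nonneg norm_ge_zero)
qed

lemma transpose_matrix_vector_sum: "transpose A *v z = (\<Sum>r\<in>UNIV. z $ r *\<^sub>R row r A)"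
  by (simp add: vec_eq_iff matrix_vector_mult_def transpose_def row_def mult.commute
      del: transpose_matrix_vector)

lemma finite_set_algorithm:
  "finite (set_pmf (iteration \<alpha> R C A b y))" "finite (set_pmf (algorithm \<alpha> R C A b K))"
proof -
  show it: "finite (set_pmf (iteration \<alpha> R C A b y))" for y
    by (auto simp: iteration_def finite_set_replicate_pmf)
  show "finite (set_pmf (algorithm \<alpha> R C A b K))"
    by (induction K) (auto simp: it)
qed

section \<open>One iteration from a fixed iterate \<open>y\<close>\<close>

context
  fixes A :: "real^'d^'n" and b y :: "real^'n" and x_star :: "real^'d" and \<alpha> :: real
    and R C :: nat
  assumes A: "A \<noteq> 0" and b: "b = A *v x_star" and C: "C > 0" and R: "R > 0"
    and \<alpha>: "\<alpha> = 1 / (spectral_norm A)\<^sup>2" and snp: "spectral_norm A > 0"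
    and R2: "2 * (frobenius_norm A)\<^sup>2 / (spectral_norm A)\<^sup>2 \<le> real R"
begin

text \<open>The terms in \<open>\<gamma>\<close> are completed to a square, so that
  \<open>expectation_replicate_pmf_norm_diff_le\<close> also applies to the average over the columns.\<close>

lemma expectation_rows_le:
  "measure_pmf.expectation (replicate_pmf R (row_pmf A))
      (\<lambda>rs. (norm (x_star - transpose A *v fold (row_update \<alpha> R A (($) \<gamma>)) rs y))\<^sup>2)
   \<le> (norm e)\<^sup>2 + 3/2 * \<alpha> * (norm (\<gamma> - (2/3) *\<^sub>R (A *v e)))\<^sup>2 - 2/3 * \<alpha> * (norm (A *v e))\<^sup>2"
  if e: "e = transpose A *v y - x_star" for e
proof -
  note transpose_matrix_vector [simp del]
  let ?F = "(frobenius_norm A)\<^sup>2"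
  have \<alpha>0: "\<alpha> > 0" "\<alpha> * (spectral_norm A)\<^sup>2 = 1" using \<alpha> snp by auto
  have F: "?F > 0" using A frobenius_norm_eq_0[of A] by simp
  \<comment> \<open>\<open>g r\<close> is the image under \<open>transpose A\<close> of the weighted
    coordinate update at \<open>r\<close>, so the whole step can be followed in the space of
    \<open>e\<close>.\<close>
  define g where "g = (\<lambda>r. (inverse (row_prob A r) * \<gamma> $ r) *\<^sub>R row r A)"
  have pr: "pmf (row_pmf A) r * ?F = (norm (row r A))\<^sup>2" for r
    using F by (simp add: pmf_row_pmf[OF A] row_prob_def)
  have g: "g = (\<lambda>r. (inverse (pmf (row_pmf A) r) * \<gamma> $ r) *\<^sub>R row r A)"
    by (simp add: g_def pmf_row_pmf[OF A])
  have mean: "measure_pmf.expectation (row_pmf A) g = transpose A *v \<gamma>"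
    unfolding g using pr by (subst expectation_importance_weighted) (auto simp: transpose_matrix_vector_sum)
  have second: "measure_pmf.expectation (row_pmf A) (\<lambda>r. (norm (g r))\<^sup>2) \<le> ?F * (norm \<gamma>)\<^sup>2"
    unfolding g using expectation_importance_weighted_norm_le[OF pr, of "($) \<gamma>"]
    by (simp add: norm_vec_def L2_set_def sum_nonneg)
  have row: "transpose A *v axis r 1 = row r A" for r
    by (simp add: matrix_vector_mult_basis vec_eq_iff column_def row_def transpose_def)
  have lin: "transpose A *v (\<Sum>r\<leftarrow>rs. (inverse (row_prob A r) * \<gamma> $ r) *\<^sub>R axis r 1) =
      (\<Sum>r\<leftarrow>rs. g r)" for rs
    by (induction rs) (auto simp: matrix_vector_right_distrib matrix_vector_mult_scaleR row g_def)
  have "x_star - transpose A *v fold (row_update \<alpha> R A (($) \<gamma>)) rs y =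
      - (e - (\<alpha> * (1 / real R)) *\<^sub>R (\<Sum>r\<leftarrow>rs. g r))" for rs
    by (simp add: fold_row_update matrix_vector_mult_diff_distrib matrix_vector_mult_scaleR lin e)
  then have "measure_pmf.expectation (replicate_pmf R (row_pmf A))
      (\<lambda>rs. (norm (x_star - transpose A *v fold (row_update \<alpha> R A (($) \<gamma>)) rs y))\<^sup>2) =
      measure_pmf.expectation (replicate_pmf R (row_pmf A))
      (\<lambda>rs. (norm (e - (\<alpha> * (1 / real R)) *\<^sub>R (\<Sum>r\<leftarrow>rs. g r)))\<^sup>2)"
    by (simp only: norm_minus_cancel)
  also have "\<dots> \<le> (norm (e - \<alpha> *\<^sub>R (transpose A *v \<gamma>)))\<^sup>2
      + \<alpha>\<^sup>2 / real R * measure_pmf.expectation (row_pmf A) (\<lambda>r. (norm (g r))\<^sup>2)"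
    using expectation_replicate_pmf_norm_diff_le[OF R, of "row_pmf A" e \<alpha> g] by (simp add: mean)
  also have "\<dots> \<le> (norm (e - \<alpha> *\<^sub>R (transpose A *v \<gamma>)))\<^sup>2 + \<alpha>\<^sup>2 / real R * (?F * (norm \<gamma>)\<^sup>2)"
    by (intro add_left_mono mult_left_mono second) auto
  \<comment> \<open>The lower bound on \<open>R\<close> enters here: it makes the row variance at
    most half of the quadratic term \<open>\<alpha> * (norm \<gamma>)\<^sup>2\<close>.\<close>
  also have "\<alpha>\<^sup>2 / real R * (?F * (norm \<gamma>)\<^sup>2) \<le> \<alpha> / 2 * (norm \<gamma>)\<^sup>2"
  proof -
    have "\<alpha> * (?F / real R) \<le> 1 / 2"
      using R2 snp R by (simp add: \<alpha> field_simps)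
    then have "\<alpha> * (\<alpha> * (?F / real R)) \<le> \<alpha> * (1 / 2)"
      using \<alpha>0 by (intro mult_left_mono) auto
    then have "\<alpha>\<^sup>2 / real R * ?F \<le> \<alpha> / 2"
      by (simp add: power2_eq_square)
    from mult_right_mono[OF this, of "(norm \<gamma>)\<^sup>2"] show ?thesis by (simp add: mult.assoc)
  qed
  also have "(norm (e - \<alpha> *\<^sub>R (transpose A *v \<gamma>)))\<^sup>2 \<le>
      (norm e)\<^sup>2 - 2 * \<alpha> * ((A *v e) \<bullet> \<gamma>) + \<alpha> * (norm \<gamma>)\<^sup>2"
  proof -
    have "\<alpha>\<^sup>2 * (norm (transpose A *v \<gamma>))\<^sup>2 \<le> \<alpha>\<^sup>2 * (spectral_norm A * norm \<gamma>)\<^sup>2"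
      by (intro mult_left_mono power_mono norm_transpose_matrix_vector_le) auto
    also have "\<dots> = \<alpha> * (\<alpha> * (spectral_norm A)\<^sup>2) * (norm \<gamma>)\<^sup>2"
      by (simp add: power_mult_distrib power2_eq_square)
    finally have "\<alpha>\<^sup>2 * (norm (transpose A *v \<gamma>))\<^sup>2 \<le> \<alpha> * (norm \<gamma>)\<^sup>2"
      by (simp only: \<alpha>0 mult_1_right)
    then show ?thesis
      by (simp add: norm_minus_sq inner_matrix_vector power_mult_distrib)
  qed
  \<comment> \<open>The quadratic coefficient \<open>\<alpha> + \<alpha> / 2\<close> puts the centre
    of the square at \<open>2/3\<close> of \<open>A *v e\<close>; the correction is
    \<open>3/2 * (2/3)\<^sup>2 = 2/3\<close>.\<close>
  also have "(norm e)\<^sup>2 - 2 * \<alpha> * ((A *v e) \<bullet> \<gamma>) + \<alpha> * (norm \<gamma>)\<^sup>2 + \<alpha> / 2 * (norm \<gamma>)\<^sup>2 =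
      (norm e)\<^sup>2 + 3/2 * \<alpha> * (norm (\<gamma> - (2/3) *\<^sub>R (A *v e)))\<^sup>2 - 2/3 * \<alpha> * (norm (A *v e))\<^sup>2"
    by (simp add: norm_minus_sq inner_commute power_mult_distrib) (simp add: power2_eq_square algebra_simps)
  finally show ?thesis by simp
qed

text \<open>Given the columns, \<open>expectation_rows_le\<close> applies to the sampled residual,
  whose mean is \<open>A *v e\<close>. That mean lies at \<open>1/3\<close> of \<open>A *v e\<close>
  from the centre of the square, so the bias adds \<open>3/2 * 1/9 = 1/6\<close>, and
  \<open>1/6 - 2/3 = - 1/2\<close>. The last summand is the column variance.\<close>

lemma expectation_iteration_le:
  "measure_pmf.expectation (iteration \<alpha> R C A b y) (\<lambda>y. (norm (x_star - transpose A *v y))\<^sup>2)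
   \<le> (norm e)\<^sup>2 - \<alpha> / 2 * (norm (A *v e))\<^sup>2
      + 3/2 * \<alpha> * ((frobenius_norm A)\<^sup>2 / real C * (norm (transpose A *v y))\<^sup>2)"
  if e: "e = transpose A *v y - x_star" for e
proof -
  note transpose_matrix_vector [simp del]
  let ?F = "(frobenius_norm A)\<^sup>2"
  let ?E = "measure_pmf.expectation (replicate_pmf C (col_pmf A))"
  have fin: "finite (set_pmf (replicate_pmf n (col_pmf A)))"
    "finite (set_pmf (replicate_pmf n (row_pmf A)))" for n
    by (simp_all add: finite_set_replicate_pmf)
  have F: "?F > 0" using A frobenius_norm_eq_0[of A] by simp
  have \<alpha>0: "\<alpha> > 0" using \<alpha> snp by auto
  define x where "x = transpose A *v y"
  have x: "(\<Sum>i\<in>UNIV. A $ i $ c * y $ i) = x $ c" for c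
    by (simp add: x_def matrix_vector_mult_def transpose_def)
  define g where "g = (\<lambda>c. (inverse (col_prob A c) * x $ c) *\<^sub>R column c A)"
  define \<gamma> where "\<gamma> cs = (1 / real C) *\<^sub>R (\<Sum>c\<leftarrow>cs. g c) - b" for cs
  have "(\<Sum>c\<leftarrow>cs. g c) $ r = (\<Sum>c\<leftarrow>cs. inverse (col_prob A c) * A $ r $ c * x $ c)" for cs r
    by (induction cs) (auto simp: g_def column_def)
  then have res: "residual C A b cs (\<lambda>c. x $ c) = ($) (\<gamma> cs)" for cs
    by (auto simp: residual_def \<gamma>_def fun_eq_iff)
  have pr: "pmf (col_pmf A) c * ?F = (norm (column c A))\<^sup>2" for c
    using F by (simp add: pmf_col_pmf[OF A] col_prob_def)
  have g: "g = (\<lambda>c. (inverse (pmf (col_pmf A) c) * x $ c) *\<^sub>R column c A)"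
    by (simp add: g_def pmf_col_pmf[OF A])
  have mean: "measure_pmf.expectation (col_pmf A) g = A *v x"
    unfolding g using pr
    by (subst expectation_importance_weighted) (auto simp: matrix_mult_sum scalar_mult_eq_scaleR)
  have second: "measure_pmf.expectation (col_pmf A) (\<lambda>c. (norm (g c))\<^sup>2) \<le> ?F * (norm x)\<^sup>2"
    unfolding g using expectation_importance_weighted_norm_le[OF pr, of "($) x"]
    by (simp add: norm_vec_def L2_set_def sum_nonneg)
  have "measure_pmf.expectation (iteration \<alpha> R C A b y) (\<lambda>y. (norm (x_star - transpose A *v y))\<^sup>2) =
    ?E (\<lambda>cs. measure_pmf.expectation (replicate_pmf R (row_pmf A))
      (\<lambda>rs. (norm (x_star - transpose A *v fold (row_update \<alpha> R A (($) (\<gamma> cs))) rs y))\<^sup>2))"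
    by (simp add: iteration_def x res expectation_bind_pmf fin)
  also have "\<dots> \<le> ?E (\<lambda>cs. (norm e)\<^sup>2 + 3/2 * \<alpha> * (norm (\<gamma> cs - (2/3) *\<^sub>R (A *v e)))\<^sup>2
      - 2/3 * \<alpha> * (norm (A *v e))\<^sup>2)"
    by (intro integral_mono expectation_rows_le e integrable_measure_pmf_finite fin)
  also have "\<dots> = (norm e)\<^sup>2 + 3/2 * \<alpha> * ?E (\<lambda>cs. (norm (\<gamma> cs - (2/3) *\<^sub>R (A *v e)))\<^sup>2)
      - 2/3 * \<alpha> * (norm (A *v e))\<^sup>2"
    by (simp add: integrable_measure_pmf_finite fin)
  \<comment> \<open>The explicit factor \<open>1\<close> matches
    \<open>expectation_replicate_pmf_norm_diff_le\<close> with \<open>a = 1\<close>.\<close>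
  also have "?E (\<lambda>cs. (norm (\<gamma> cs - (2/3) *\<^sub>R (A *v e)))\<^sup>2) =
      ?E (\<lambda>cs. (norm (b + (2/3) *\<^sub>R (A *v e) - (1 * (1 / real C)) *\<^sub>R (\<Sum>c\<leftarrow>cs. g c)))\<^sup>2)"
    unfolding \<gamma>_def by (subst norm_minus_commute) (simp add: algebra_simps)
  also have "\<dots> \<le> (norm (b + (2/3) *\<^sub>R (A *v e) - 1 *\<^sub>R (A *v x)))\<^sup>2
      + 1\<^sup>2 / real C * measure_pmf.expectation (col_pmf A) (\<lambda>c. (norm (g c))\<^sup>2)"
    unfolding mean[symmetric] by (rule expectation_replicate_pmf_norm_diff_le[OF C])
  also have "\<dots> \<le> (norm (b + (2/3) *\<^sub>R (A *v e) - 1 *\<^sub>R (A *v x)))\<^sup>2 + 1\<^sup>2 / real C * (?F * (norm x)\<^sup>2)"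
    by (intro add_left_mono mult_left_mono second) auto
  also have "b + (2/3) *\<^sub>R (A *v e) - 1 *\<^sub>R (A *v x) = - (1/3) *\<^sub>R (A *v e)"
  proof -
    have "A *v x = A *v e + b"
      by (simp add: e b x_def matrix_vector_mult_diff_distrib)
    then show ?thesis by (simp add: vec_eq_iff algebra_simps)
  qed
  finally show ?thesis
    using \<alpha>0 by (simp add: x_def power_divide ring_distribs)
qed

end

section \<open>Pseudoinverse and condition number\<close>

lemma spectral_norm_pos:
  assumes "A \<noteq> 0"
  shows "spectral_norm A > 0"
proof (rule ccontr)
  assume "\<not> spectral_norm A > 0"
  then have "norm (A *v x) \<le> 0" for x
    by (intro order_trans[OF norm_matrix_vector_le] mult_nonpos_nonneg) auto
  then have "A = 0"
    by (simp add: matrix_eq)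
  then show False using assms by simp
qed

lemma pinv_nonzero:
  assumes "A \<noteq> 0"
  shows "pinv A \<noteq> 0"
proof
  assume "pinv A = 0"
  then have "A = A ** 0 ** A"
    using is_pinv_pinv[of A] by (simp add: is_pinv_def)
  then show False using assms by simp
qed

text \<open>\<open>A ** pinv A\<close> fixes every vector in the range of \<open>A\<close>, so its
  norm cannot be below 1.\<close>

lemma cond_num_ge_1:
  assumes "A \<noteq> 0"
  shows "cond_num A \<ge> 1"
proof -
  have pos: "spectral_norm A > 0"
    using assms by (rule spectral_norm_pos)
  obtain x where x: "A *v x \<noteq> 0"
    using assms by (auto simp: matrix_eq)
  have "A *v x = A *v (pinv A *v (A *v x))"
    using is_pinv_pinv[of A] by (simp add: is_pinv_def matrix_vector_mul_assoc matrix_mul_assoc)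
  also have "norm \<dots> \<le> spectral_norm A * (spectral_norm (pinv A) * norm (A *v x))"
    using pos by (intro order_trans[OF norm_matrix_vector_le] mult_left_mono norm_matrix_vector_le) auto
  finally show ?thesis
    using x by (simp add: cond_num_def flip: mult.assoc)
qed

text \<open>\<open>pinv A ** A\<close> is the orthogonal projection onto the row space. Applied to
  the error, this yields the lower bound on \<open>norm (A *v e)\<close> that drives the
  contraction.\<close>

lemma pinv_mult_transpose:
  "pinv A *v (A *v (transpose A *v z)) = transpose A *v z"
proof -
  have "transpose A = transpose (A ** (pinv A ** A))"
    using is_pinv_pinv[of A] by (simp add: is_pinv_def matrix_mul_assoc)
  also have "\<dots> = pinv A ** A ** transpose A"
    using is_pinv_pinv[of A] by (simp only: matrix_transpose_mul[of A] is_pinv_def)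
  finally show ?thesis
    by (metis matrix_vector_mul_assoc)
qed

section \<open>Affine recurrence and choice of constants\<close>

lemma linear_recurrence_le:
  fixes E :: "nat \<Rightarrow> real"
  assumes step: "\<And>k. E (Suc k) \<le> (1 - t) * E k + c" and t: "0 < t" "t \<le> 1" and "0 \<le> c" "0 \<le> E 0"
  shows "E k \<le> exp (- (t * real k)) * E 0 + c / t"
proof -
  \<comment> \<open>\<open>c / t\<close> is the fixed point of the map sending \<open>s\<close> to
    \<open>(1 - t) * s + c\<close>.\<close>
  have "E k \<le> (1 - t) ^ k * E 0 + c / t"
  proof (induction k)
    case 0
    then show ?case using assms by simp
  next
    case (Suc k)
    have "E (Suc k) \<le> (1 - t) * ((1 - t) ^ k * E 0 + c / t) + c"
      using step[of k] mult_left_mono[OF Suc.IH, of "1 - t"] t by linarith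
    also have "\<dots> = (1 - t) ^ Suc k * E 0 + c / t"
      using t by (simp add: field_simps)
    finally show ?case .
  qed
  moreover have "(1 - t) ^ k \<le> exp (- t) ^ k"
    using exp_ge_add_one_self[of "- t"] t by (intro power_mono) auto
  then have "(1 - t) ^ k * E 0 \<le> exp (- (t * real k)) * E 0"
    using assms by (intro mult_right_mono) (auto simp: mult.commute simp flip: exp_of_nat_mult)
  ultimately show ?thesis by linarith
qed

text \<open>The sampling error costs \<open>3/10 * \<epsilon>\<^sup>2\<close> in the contraction rate, hence a factor
  \<open>\<epsilon> powr (- 6/5 * \<epsilon>\<^sup>2)\<close> after \<open>K\<close> steps, which stays bounded as \<open>\<epsilon>\<close> tends to \<open>0\<close>.\<close>

lemma final_accuracy:
  fixes \<epsilon> :: real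
  assumes \<epsilon>: "0 < \<epsilon>" "\<epsilon> < 1/4"
  shows "exp (- (4 * (1/2 - 3/10 * \<epsilon>\<^sup>2) * ln (1 / \<epsilon>))) + 3/10 * \<epsilon>\<^sup>2 / (1/2 - 3/10 * \<epsilon>\<^sup>2) \<le> 2 * \<epsilon>\<^sup>2"
proof -
  have \<epsilon>2: "\<epsilon>\<^sup>2 < 1/16"
    using power_strict_mono[OF \<epsilon>(2), of 2] \<epsilon> by (simp add: power2_eq_square)
  have "\<epsilon>\<^sup>2 * ln (1 / \<epsilon>) \<le> \<epsilon>\<^sup>2 * (1 / \<epsilon> - 1)"
    using \<epsilon> by (intro mult_left_mono ln_le_minus_one) auto
  also have "\<dots> = \<epsilon> - \<epsilon>\<^sup>2"
    using \<epsilon> by (simp add: power2_eq_square field_simps)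
  \<comment> \<open>\<open>3/16\<close> is the value at \<open>\<epsilon> = 1/4\<close>; the product
    used has its roots at \<open>1/4\<close> and \<open>3/4\<close>.\<close>
  also have "\<dots> \<le> 3/16"
    using \<epsilon> mult_nonneg_nonneg[of "1 - 4 * \<epsilon>" "3 - 4 * \<epsilon>"]
    by (simp add: power2_eq_square algebra_simps)
  finally have "exp (6/5 * (\<epsilon>\<^sup>2 * ln (1 / \<epsilon>))) \<le> exp (9/40)"
    by (simp add: mult.commute)
  also have "\<dots> \<le> 1 + 9/40 + (9/40)\<^sup>2" by (rule exp_bound) auto
  also have "\<dots> \<le> 13/10" by (simp add: power2_eq_square)
  finally have e: "exp (6/5 * (\<epsilon>\<^sup>2 * ln (1 / \<epsilon>))) \<le> 13/10" .
  have "exp (- (4 * (1/2 - 3/10 * \<epsilon>\<^sup>2) * ln (1 / \<epsilon>))) = exp (2 * ln \<epsilon> + 6/5 * (\<epsilon>\<^sup>2 * ln (1 / \<epsilon>)))"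
    using \<epsilon> by (simp add: ln_div algebra_simps)
  also have "\<dots> = \<epsilon>\<^sup>2 * exp (6/5 * (\<epsilon>\<^sup>2 * ln (1 / \<epsilon>)))"
    using \<epsilon> by (simp add: exp_add exp_double)
  also have "\<dots> \<le> \<epsilon>\<^sup>2 * (13/10)"
    using e by (intro mult_left_mono) auto
  finally have "exp (- (4 * (1/2 - 3/10 * \<epsilon>\<^sup>2) * ln (1 / \<epsilon>))) \<le> \<epsilon>\<^sup>2 * (13/10)" .
  \<comment> \<open>With \<open>3/7\<close> as lower bound of the denominator the quotient is
    \<open>7/10 * \<epsilon>\<^sup>2\<close>, exactly what \<open>13/10 * \<epsilon>\<^sup>2\<close>
    leaves of the target.\<close>
  moreover have "3/10 * \<epsilon>\<^sup>2 / (1/2 - 3/10 * \<epsilon>\<^sup>2) \<le> 3/10 * \<epsilon>\<^sup>2 / (3/7)"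
    using \<epsilon>2 by (intro divide_left_mono) auto
  ultimately show ?thesis by simp
qed

theorem theorem2:
  fixes A :: "real^'d^'n" and b :: "real^'n" and x_star :: "real^'d"
    and \<epsilon> \<alpha> :: real and R C K :: nat
  assumes "A \<noteq> 0"
    and "b \<in> range ((*v) A)"
    and "x_star = pinv A *v b"
    and "0 < \<epsilon>" and "\<epsilon> < 1/4"
    and "\<alpha> = 1 / (spectral_norm A)\<^sup>2"
    and "R = nat \<lceil>2 * (cond_num_F A)\<^sup>2 / (cond_num A)\<^sup>2\<rceil>"
    and "C = nat \<lceil>10 * (cond_num_F A)\<^sup>2 / \<epsilon>\<^sup>2\<rceil>"
    and "K = nat \<lceil>4 * (cond_num A)\<^sup>2 * ln (1 / \<epsilon>)\<rceil>"
  shows "measure_pmf.expectation (algorithm \<alpha> R C A b K)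
           (\<lambda>y. (norm (x_star - transpose A *v y))\<^sup>2) \<le> 2 * \<epsilon>\<^sup>2 * (norm x_star)\<^sup>2"
proof -
  note transpose_matrix_vector [simp del]
  let ?F = "frobenius_norm A" and ?n = "spectral_norm A" and ?s = "spectral_norm (pinv A)"
  let ?\<kappa> = "cond_num A"
  note \<epsilon> = assms(4,5)
  have \<epsilon>2: "0 < \<epsilon>\<^sup>2" "\<epsilon>\<^sup>2 < 1/16"
    using power_strict_mono[OF \<epsilon>(2), of 2] \<epsilon> by (auto simp: power2_eq_square)
  have n: "?n > 0" and s: "?s > 0"
    using assms(1) by (simp_all add: spectral_norm_pos pinv_nonzero)
  have F: "?F \<noteq> 0"
    using assms(1) by (simp add: frobenius_norm_eq_0)
  have \<kappa>: "?\<kappa> \<ge> 1"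
    using assms(1) by (rule cond_num_ge_1)
  \<comment> \<open>In this form the factor \<open>?s\<^sup>2\<close> meets both the bound on
    \<open>norm e\<close> and the one on \<open>C\<close>.\<close>
  have \<alpha>: "\<alpha> = ?s\<^sup>2 / ?\<kappa>\<^sup>2"
    using n s by (simp add: assms(6) cond_num_def power_mult_distrib)
  have R_ge: "2 * ?F\<^sup>2 / ?n\<^sup>2 \<le> real R"
    using s real_nat_ceiling_ge[of "2 * (cond_num_F A)\<^sup>2 / ?\<kappa>\<^sup>2"]
    by (simp add: assms(7) cond_num_def cond_num_F_def power_mult_distrib)
  have C_ge: "10 * (?F\<^sup>2 * ?s\<^sup>2) / \<epsilon>\<^sup>2 \<le> real C"
    using real_nat_ceiling_ge[of "10 * (cond_num_F A)\<^sup>2 / \<epsilon>\<^sup>2"]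
    by (simp add: assms(8) cond_num_F_def power_mult_distrib)
  have R: "R > 0" and C: "C > 0"
  proof -
    have "0 < 2 * ?F\<^sup>2 / ?n\<^sup>2" "0 < 10 * (?F\<^sup>2 * ?s\<^sup>2) / \<epsilon>\<^sup>2"
      using n F s \<epsilon> by simp_all
    then have "0 < real R" "0 < real C"
      using R_ge C_ge by linarith+
    then show "R > 0" "C > 0" by simp_all
  qed
  have b: "b = A *v x_star"
    using assms(2,3) is_pinv_pinv[of A]
    by (auto simp: is_pinv_def matrix_vector_mul_assoc matrix_mul_assoc)
  have x_star: "pinv A *v (A *v x_star) = x_star"
    using b assms(3) by simp

  define f where "f y = (norm (x_star - transpose A *v y))\<^sup>2" for y
  define E where "E k = measure_pmf.expectation (algorithm \<alpha> R C A b k) f" for k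
  \<comment> \<open>\<open>1/2\<close> comes from \<open>expectation_iteration_le\<close>. The loss
    \<open>3/10\<close> is \<open>3/2 * 1/10 * 2\<close>: the factor of the noise term, the bound
    from \<open>C\<close>, and the split of \<open>(norm x)\<^sup>2\<close> into error and solution;
    the solution part becomes \<open>c\<close>.\<close>
  define t where "t = (1/2 - 3/10 * \<epsilon>\<^sup>2) / ?\<kappa>\<^sup>2"
  define c where "c = 3/10 * \<epsilon>\<^sup>2 / ?\<kappa>\<^sup>2 * (norm x_star)\<^sup>2"
  have step: "measure_pmf.expectation (iteration \<alpha> R C A b y) f \<le> (1 - t) * f y + c" for y
  proof -
    define x where "x = transpose A *v y"
    define e where "e = x - x_star"
    have f: "f y = (norm e)\<^sup>2"
      by (simp add: f_def e_def x_def norm_minus_commute)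
    have "e = pinv A *v (A *v e)"
      by (simp add: e_def x_def pinv_mult_transpose x_star matrix_vector_mult_diff_distrib)
    then have "norm e \<le> ?s * norm (A *v e)"
      using norm_matrix_vector_le[of "pinv A" "A *v e"] by simp
    then have "(norm e)\<^sup>2 \<le> (?s * norm (A *v e))\<^sup>2"
      by (rule power_mono) simp
    then have "(norm e)\<^sup>2 / ?\<kappa>\<^sup>2 \<le> (?s * norm (A *v e))\<^sup>2 / ?\<kappa>\<^sup>2"
      by (rule divide_right_mono) simp
    then have contract: "(norm e)\<^sup>2 / ?\<kappa>\<^sup>2 \<le> \<alpha> * (norm (A *v e))\<^sup>2"
      by (simp add: \<alpha> power_mult_distrib)
    have "?F\<^sup>2 * ?s\<^sup>2 / real C \<le> \<epsilon>\<^sup>2 / 10"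
      using C_ge C \<epsilon>2 by (simp add: field_simps)
    then have "?F\<^sup>2 * ?s\<^sup>2 / real C / ?\<kappa>\<^sup>2 \<le> \<epsilon>\<^sup>2 / 10 / ?\<kappa>\<^sup>2"
      by (rule divide_right_mono) simp
    then have "\<alpha> * (?F\<^sup>2 / real C) \<le> \<epsilon>\<^sup>2 / 10 / ?\<kappa>\<^sup>2"
      by (simp add: \<alpha> mult_ac)
    \<comment> \<open>Parallelogram law: the difference of the two sides is
      \<open>(norm (e - x_star))\<^sup>2\<close>.\<close>
    moreover have "(norm x)\<^sup>2 \<le> 2 * (norm e)\<^sup>2 + 2 * (norm x_star)\<^sup>2"
    proof -
      have "x = e + x_star" by (simp add: e_def)
      then show ?thesis
        using zero_le_power2[of "norm (e - x_star)"]
        by (simp only: norm_plus_sq norm_minus_sq)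
    qed
    ultimately have "\<alpha> * (?F\<^sup>2 / real C) * (norm x)\<^sup>2 \<le> \<epsilon>\<^sup>2 / 10 / ?\<kappa>\<^sup>2 * (2 * (norm e)\<^sup>2 + 2 * (norm x_star)\<^sup>2)"
      by (rule mult_mono) auto
    then have noise: "3/2 * \<alpha> * (?F\<^sup>2 / real C * (norm x)\<^sup>2) \<le>
        3/10 * \<epsilon>\<^sup>2 / ?\<kappa>\<^sup>2 * (norm e)\<^sup>2 + c"
      by (simp add: c_def add_divide_distrib ring_distribs mult.assoc)
    have "measure_pmf.expectation (iteration \<alpha> R C A b y) f \<le> (norm e)\<^sup>2 - \<alpha> / 2 * (norm (A *v e))\<^sup>2
      + 3/2 * \<alpha> * (?F\<^sup>2 / real C * (norm x)\<^sup>2)"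
      using expectation_iteration_le[OF assms(1) b C R assms(6) n R_ge e_def[unfolded x_def]]
      by (simp add: f_def[abs_def] x_def)
    also have "\<dots> \<le> (norm e)\<^sup>2 - 1/2 * ((norm e)\<^sup>2 / ?\<kappa>\<^sup>2) + (3/10 * \<epsilon>\<^sup>2 / ?\<kappa>\<^sup>2 * (norm e)\<^sup>2 + c)"
      using contract noise by simp
    also have "\<dots> = (1 - t) * f y + c"
      by (simp add: t_def f diff_divide_distrib left_diff_distrib)
    finally show ?thesis .
  qed
  have "E (Suc k) \<le> (1 - t) * E k + c" for k
  proof -
    have "E (Suc k) = measure_pmf.expectation (algorithm \<alpha> R C A b k)
        (\<lambda>y. measure_pmf.expectation (iteration \<alpha> R C A b y) f)"
      by (simp add: E_def expectation_bind_pmf finite_set_algorithm)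
    also have "\<dots> \<le> measure_pmf.expectation (algorithm \<alpha> R C A b k) (\<lambda>y. (1 - t) * f y + c)"
      by (intro integral_mono integrable_measure_pmf_finite finite_set_algorithm step)
    finally show ?thesis
      by (simp add: E_def integrable_measure_pmf_finite finite_set_algorithm)
  qed
  moreover have E0: "E 0 = (norm x_star)\<^sup>2"
    by (simp add: E_def f_def)
  moreover have t: "0 < t" "t \<le> 1"
  proof -
    show "0 < t"
      using \<epsilon>2 \<kappa> by (simp add: t_def)
    have "1/2 - 3/10 * \<epsilon>\<^sup>2 \<le> ?\<kappa>\<^sup>2"
      using one_le_power[OF \<kappa>, of 2] \<epsilon>2 by linarith
    then show "t \<le> 1"
      using \<kappa> by (simp add: t_def)
  qed
  moreover have "0 \<le> c"
    by (simp add: c_def)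
  ultimately have "E K \<le> exp (- (t * real K)) * (norm x_star)\<^sup>2 + c / t"
    using linear_recurrence_le[of E t c K] by simp
  \<comment> \<open>Rounding \<open>K\<close> up only helps, and its factor
    \<open>?\<kappa>\<^sup>2\<close> cancels the one in \<open>t\<close>.\<close>
  moreover have "exp (- (t * real K)) \<le> exp (- (4 * (1/2 - 3/10 * \<epsilon>\<^sup>2) * ln (1 / \<epsilon>)))"
  proof -
    have "t * (4 * ?\<kappa>\<^sup>2 * ln (1 / \<epsilon>)) \<le> t * real K"
      using t by (intro mult_left_mono) (simp_all add: assms(9) real_nat_ceiling_ge)
    moreover have "t * (4 * ?\<kappa>\<^sup>2 * ln (1 / \<epsilon>)) = 4 * (1/2 - 3/10 * \<epsilon>\<^sup>2) * ln (1 / \<epsilon>)"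
      using \<kappa> by (simp add: t_def)
    ultimately show ?thesis by simp
  qed
  moreover have "c / t = 3/10 * \<epsilon>\<^sup>2 / (1/2 - 3/10 * \<epsilon>\<^sup>2) * (norm x_star)\<^sup>2"
    using \<kappa> by (simp add: c_def t_def)
  ultimately have "E K \<le> (exp (- (4 * (1/2 - 3/10 * \<epsilon>\<^sup>2) * ln (1 / \<epsilon>))) +
      3/10 * \<epsilon>\<^sup>2 / (1/2 - 3/10 * \<epsilon>\<^sup>2)) * (norm x_star)\<^sup>2"
    unfolding distrib_right by (smt (verit) mult_right_mono zero_le_power2)
  also have "\<dots> \<le> 2 * \<epsilon>\<^sup>2 * (norm x_star)\<^sup>2"
    by (intro mult_right_mono final_accuracy \<epsilon>) simp
  finally show ?thesis
    by (simp add: E_def f_def[abs_def])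
qed

end
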